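(* Let $\mathcal{A}$ be a nonempty central hyperplane arrangement over a field of characteristic zero. Then $$\mathsf{fHP}_{\mathcal{A}}\left(Y^{-1}, (T_x^{-1})_{x\in\widetilde{\mathcal{L}}(\mathcal{A})}\right) = (-Y)^{-\mathrm{rk}(\mathcal{A})}\, T_{\hat{1}}\cdot \mathsf{fHP}_{\mathcal{A}}(Y,\boldsymbol{T}).$$
   Context: A hyperplane arrangement over a field $\mathbb{K}$ is a finite set $\mathcal{A}$ of affine hyperplanes in $\mathbb{K}^d$. Its intersection poset $\mathcal{L}(\mathcal{A})$ is the set of all nonempty intersections of subsets of $\mathcal{A}$ (including the empty intersection $\mathbb{K}^d$), ordered by reverse inclusion; its bottom element is $\hat{0}=\mathbb{K}^d$. $\mathcal{A}$ is central if $\bigcap_{H\in\mathcal{A}}H\neq\varnothing$; equivalently $\mathcal{L}(\mathcal{A})$ has a top element $\hat{1}$. Put $\widetilde{\mathcal{L}}(\mathcal{A})=\mathcal{L}(\mathcal{A})\setminus\{\hat{0}\}$. For $x\in\mathcal{L}(\mathcal{A})$, $\mathrm{rk}(x)$ is the supremum of the lengths of chains from $\hat{0}$ to $x$; $\mathrm{rk}(\mathcal{A})$ is the rank of a maximal element of $\mathcal{L}(\mathcal{A})$. For a poset $P$, $\Delta(P)$ denotes the set of all finite flags $F=(x_1<\cdots<x_\ell)$ in $P$, $\ell\geq 0$, including the empty flag. For $x\in\mathcal{L}(\mathcal{A})$ let $\mathcal{A}_x=\{H\in\mathcal{A}\mid x\subseteq H\}$ and let $\mathcal{A}^x=\{x\cap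 H\mid H\in\mathcal{A}\setminus\mathcal{A}_x,\ x\cap H\neq\varnothing\}$, an arrangement in the affine space $x$. Set $\mathcal{A}_{\emptyset}:=\mathcal{A}$ (here $\emptyset$ is a formal symbol) and $\mathcal{A}^x_y:=(\mathcal{A}_y)^x$. The Poincaré polynomial is $\pi_{\mathcal{A}}(Y)=\sum_{x\in\mathcal{L}(\mathcal{A})}\mu(x)(-Y)^{\mathrm{rk}(x)}$, where $\mu(x)=\mu(\hat{0},x)$ is the Möbius function of $\mathcal{L}(\mathcal{A})$. For a flag $F=(x_1<\cdots<x_\ell)\in\Delta(\mathcal{L}(\mathcal{A}))$ put $x_0=\hat{0}$, $x_{\ell+1}=\emptyset$ and $\pi_F(Y)=\prod_{k=0}^{\ell}\pi_{\mathcal{A}^{x_k}_{x_{k+1}}}(Y)$. With indeterminates $\boldsymbol{T}=(T_x)_{x\in\widetilde{\mathcal{L}}(\mathcal{A})}$, the flag Hilbert–Poincaré series of $\mathcal{A}$ is $$\mathsf{fHP}_{\mathcal{A}}(Y,\boldsymbol{T})=\sum_{F\in\Delta(\widetilde{\mathcal{L}}(\mathcal{A}))}\pi_F(Y)\prod_{x\in F}\frac{T_x}{1-T_x}\in\mathbb{Q}(\boldsymbol{T})[Y].$$ *)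

theory Defs
  imports
    "HOL-Analysis.Analysis"
    "HOL-Library.Poly_Mapping"
    "HOL-Computational_Algebra.Polynomial_Factorial"
begin

section \<open>Polynomials over the rationals in arbitrary indeterminates\<close>

text \<open>
  The polynomial ring over the rationals in indeterminates indexed by an arbitrary type.
  The library already provides the ring structure of \<open>('v \<Rightarrow>\<^sub>0 nat) \<Rightarrow>\<^sub>0 rat\<close>, but shows that it is
  an integral domain only for a linearly ordered index type \<open>'v\<close>.  The type copy serves to give
  the \<open>idom\<close> instance without any assumption on \<open>'v\<close>.
\<close>

typedef 'v ratpoly = "UNIV :: (('v \<Rightarrow>\<^sub>0 nat) \<Rightarrow>\<^sub>0 rat) set"
  by simp

setup_lifting type_definition_ratpoly

lemma unique_sum_of_exponents:
  fixes A B :: "('v \<Rightarrow>\<^sub>0 nat) set"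
  assumes "finite V" "finite A" "finite B" "A \<noteq> {}" "B \<noteq> {}"
    and "\<And>a a' v. a \<in> A \<Longrightarrow> a' \<in> A \<Longrightarrow> v \<notin> V \<Longrightarrow> Poly_Mapping.lookup a v = Poly_Mapping.lookup a' v"
    and "\<And>b b' v. b \<in> B \<Longrightarrow> b' \<in> B \<Longrightarrow> v \<notin> V \<Longrightarrow> Poly_Mapping.lookup b v = Poly_Mapping.lookup b' v"
  shows "\<exists>a\<in>A. \<exists>b\<in>B. \<forall>a'\<in>A. \<forall>b'\<in>B. a' + b' = a + b \<longrightarrow> a' = a \<and> b' = b"
  using assms
proof (induction V arbitrary: A B rule: finite_induct)
  case empty
  obtain a b where ab: "a \<in> A" "b \<in> B"
    using empty.prems by blast
  have "a' = a" if "a' \<in> A" for a'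
    using empty.prems(5)[OF that ab(1)] by (intro poly_mapping_eqI) simp
  moreover have "b' = b" if "b' \<in> B" for b'
    using empty.prems(6)[OF that ab(2)] by (intro poly_mapping_eqI) simp
  ultimately show ?case
    using ab by blast
next
  case (insert v V)
  define m where "m = Max ((\<lambda>a. Poly_Mapping.lookup a v) ` A)"
  define n where "n = Max ((\<lambda>b. Poly_Mapping.lookup b v) ` B)"
  define A' where "A' = {a \<in> A. Poly_Mapping.lookup a v = m}"
  define B' where "B' = {b \<in> B. Poly_Mapping.lookup b v = n}"
  have m: "Poly_Mapping.lookup a v \<le> m" if "a \<in> A" for a
    using that insert.prems(1) by (simp add: m_def)
  have n: "Poly_Mapping.lookup b v \<le> n" if "b \<in> B" for b
    using that insert.prems(2) by (simp add: n_def)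
  have "m \<in> (\<lambda>a. Poly_Mapping.lookup a v) ` A"
    unfolding m_def using insert.prems by (intro Max_in) auto
  then have A': "A' \<noteq> {}" by (auto simp: A'_def)
  have "n \<in> (\<lambda>b. Poly_Mapping.lookup b v) ` B"
    unfolding n_def using insert.prems by (intro Max_in) auto
  then have B': "B' \<noteq> {}" by (auto simp: B'_def)
  have "\<exists>a\<in>A'. \<exists>b\<in>B'. \<forall>a'\<in>A'. \<forall>b'\<in>B'. a' + b' = a + b \<longrightarrow> a' = a \<and> b' = b"
  proof (rule insert.IH)
    show "Poly_Mapping.lookup a w = Poly_Mapping.lookup a' w" if "a \<in> A'" "a' \<in> A'" "w \<notin> V" for a a' w
      using that insert.prems(5)[of a a' w] by (cases "w = v") (auto simp: A'_def)
    show "Poly_Mapping.lookup b w = Poly_Mapping.lookup b' w" if "b \<in> B'" "b' \<in> B'" "w \<notin> V" for b b' w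
      using that insert.prems(6)[of b b' w] by (cases "w = v") (auto simp: B'_def)
  qed (use A' B' insert.prems in \<open>auto simp: A'_def B'_def\<close>)
  then obtain a b where ab: "a \<in> A'" "b \<in> B'"
    and *: "\<And>a' b'. a' \<in> A' \<Longrightarrow> b' \<in> B' \<Longrightarrow> a' + b' = a + b \<Longrightarrow> a' = a \<and> b' = b"
    by blast
  have "a' = a \<and> b' = b" if a': "a' \<in> A" and b': "b' \<in> B" and eq: "a' + b' = a + b" for a' b'
  proof -
    have "Poly_Mapping.lookup a' v + Poly_Mapping.lookup b' v = m + n"
      using arg_cong[OF eq, of "\<lambda>p. Poly_Mapping.lookup p v"] ab by (simp add: lookup_add A'_def B'_def)
    then have "Poly_Mapping.lookup a' v = m" "Poly_Mapping.lookup b' v = n"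
      using m[OF a'] n[OF b'] by linarith+
    then show ?thesis
      using * a' b' eq by (simp add: A'_def B'_def)
  qed
  then show ?case
    using ab by (auto simp: A'_def B'_def)
qed

lemma mult_exponents_nonzero:
  fixes p q :: "('v \<Rightarrow>\<^sub>0 nat) \<Rightarrow>\<^sub>0 rat"
  assumes "p \<noteq> 0" "q \<noteq> 0"
  shows "p * q \<noteq> 0"
proof -
  define V where "V = (\<Union>a \<in> Poly_Mapping.keys p \<union> Poly_Mapping.keys q. Poly_Mapping.keys a)"
  have V: "Poly_Mapping.lookup a v = 0" if "a \<in> Poly_Mapping.keys p \<union> Poly_Mapping.keys q" "v \<notin> V" for a v
    using that by (auto simp: V_def in_keys_iff)
  have "\<exists>a\<in>Poly_Mapping.keys p. \<exists>b\<in>Poly_Mapping.keys q. \<forall>a'\<in>Poly_Mapping.keys p. \<forall>b'\<in>Poly_Mapping.keys q.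
      a' + b' = a + b \<longrightarrow> a' = a \<and> b' = b"
    by (rule unique_sum_of_exponents[of V]) (use assms V in \<open>auto simp: V_def\<close>)
  then obtain a b where ab: "a \<in> Poly_Mapping.keys p" "b \<in> Poly_Mapping.keys q"
    and u: "\<And>a' b'. a' \<in> Poly_Mapping.keys p \<Longrightarrow> b' \<in> Poly_Mapping.keys q \<Longrightarrow> a' + b' = a + b \<Longrightarrow> a' = a \<and> b' = b"
    by blast
  have 1: "(\<Sum>q'. Poly_Mapping.lookup q q' when a + b = l + q') = (Poly_Mapping.lookup q b when l = a)"
    if "l \<in> Poly_Mapping.keys p" for l
  proof -
    have "(\<Sum>q'. Poly_Mapping.lookup q q' when a + b = l + q')
        = (\<Sum>q'. (Poly_Mapping.lookup q q' when l = a) when q' = b)"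
    proof (rule Sum_any.cong)
      fix q'
      show "(Poly_Mapping.lookup q q' when a + b = l + q') = ((Poly_Mapping.lookup q q' when l = a) when q' = b)"
        using u[OF that, of q'] by (cases "q' \<in> Poly_Mapping.keys q") (auto simp: when_def in_keys_iff)
    qed
    then show ?thesis by simp
  qed
  have "Poly_Mapping.lookup (p * q) (a + b)
      = (\<Sum>l. Poly_Mapping.lookup p l * (\<Sum>q'. Poly_Mapping.lookup q q' when a + b = l + q'))"
    by (rule lookup_mult)
  also have "\<dots> = (\<Sum>l. (Poly_Mapping.lookup p l * Poly_Mapping.lookup q b) when l = a)"
  proof (rule Sum_any.cong)
    fix l
    show "Poly_Mapping.lookup p l * (\<Sum>q'. Poly_Mapping.lookup q q' when a + b = l + q')
        = ((Poly_Mapping.lookup p l * Poly_Mapping.lookup q b) when l = a)"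
      using 1[of l] by (cases "l \<in> Poly_Mapping.keys p") (auto simp: when_def in_keys_iff)
  qed
  also have "\<dots> = Poly_Mapping.lookup p a * Poly_Mapping.lookup q b" by simp
  finally have "Poly_Mapping.lookup (p * q) (a + b) \<noteq> 0"
    using ab by (simp add: in_keys_iff)
  then show ?thesis by auto
qed

instantiation ratpoly :: (type) idom
begin

lift_definition zero_ratpoly :: "'v ratpoly" is 0 .
lift_definition one_ratpoly :: "'v ratpoly" is 1 .
lift_definition plus_ratpoly :: "'v ratpoly \<Rightarrow> 'v ratpoly \<Rightarrow> 'v ratpoly" is "(+)" .
lift_definition minus_ratpoly :: "'v ratpoly \<Rightarrow> 'v ratpoly \<Rightarrow> 'v ratpoly" is "(-)" .
lift_definition uminus_ratpoly :: "'v ratpoly \<Rightarrow> 'v ratpoly" is uminus .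
lift_definition times_ratpoly :: "'v ratpoly \<Rightarrow> 'v ratpoly \<Rightarrow> 'v ratpoly" is "(*)" .

instance
  by standard (transfer; simp add: algebra_simps mult_exponents_nonzero)+

end

lift_definition indet :: "'v \<Rightarrow> 'v ratpoly"
  is "\<lambda>v. Poly_Mapping.single (Poly_Mapping.single v 1) 1" .

text \<open>
  \<open>'v ratpoly fract\<close> is the field \<open>\<rat>(\<^bold>T)\<close> of rational functions in indeterminates
  \<open>T\<^sub>v\<close>, and \<open>'v ratpoly fract poly\<close> is \<open>\<rat>(\<^bold>T)[Y]\<close>.  Since \<open>Y\<close> gets inverted
  as well, everything takes place in the fraction field \<open>\<rat>(\<^bold>T)(Y)\<close> of the latter.
\<close>

type_synonym 'v ratfun = "'v ratpoly fract poly fract"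

definition indet_Y :: "'v ratfun" where
  "indet_Y = to_fract [:0, 1:]"

definition indet_T :: "'v \<Rightarrow> 'v ratfun" where
  "indet_T v = to_fract [:to_fract (indet v):]"


section \<open>Posets of sets ordered by reverse inclusion\<close>

text \<open>
  A flag \<open>x\<^sub>1 < \<dots> < x\<^sub>l\<close> is represented by the list of its elements, so \<open>[]\<close> is the empty flag.
  In all posets below \<open>x < y\<close> means \<open>y \<subset> x\<close>.
\<close>

definition flags :: "'p set set \<Rightarrow> 'p set list set" where
  "flags P = {F. set F \<subseteq> P \<and> sorted_wrt (\<lambda>x y. y \<subset> x) F}"

definition poset_rank :: "'p set set \<Rightarrow> 'p set \<Rightarrow> 'p set \<Rightarrow> nat" where
  "poset_rank P b x = Sup {k. \<exists>F\<in>flags P. length F = Suc k \<and> hd F = b \<and> last F = x}"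

text \<open>
  The Moebius function: \<open>\<mu>(x,x) = 1\<close>, \<open>\<mu>(x,y) = - (\<Sum>x \<le> z < y. \<mu>(x,z))\<close> if \<open>x < y\<close>, and
  \<open>\<mu>(x,y) = 0\<close> otherwise.  The finiteness test only serves to make the recursion terminate.
\<close>

function moebius :: "'p set set \<Rightarrow> 'p set \<Rightarrow> 'p set \<Rightarrow> int" where
  "moebius P x y =
    (if x = y then 1
     else if finite P \<and> y \<subset> x then - (\<Sum>z \<in> {z \<in> P. y \<subset> z \<and> z \<subseteq> x}. moebius P x z)
     else 0)"
  by pat_completeness auto
termination
proof (relation "Wellfounded.measure (\<lambda>(P, x, y). card {w \<in> P. y \<subset> w})")
  fix P :: "'p set set" and x y z
  assume "finite P \<and> y \<subset> x" "z \<in> {z \<in> P. y \<subset> z \<and> z \<subseteq> x}"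
  then have "{w \<in> P. z \<subset> w} \<subset> {w \<in> P. y \<subset> w}" "finite {w \<in> P. y \<subset> w}"
    by auto
  then show "((P, x, z), (P, x, y)) \<in> Wellfounded.measure (\<lambda>(P, x, y). card {w \<in> P. y \<subset> w})"
    by (simp add: psubset_card_mono)
qed simp

declare moebius.simps [simp del]


section \<open>Hyperplane arrangements\<close>

definition affine_hyperplane :: "('k::field ^ 'n) set \<Rightarrow> bool" where
  "affine_hyperplane H \<longleftrightarrow> (\<exists>a c. a \<noteq> 0 \<and> H = {v. (\<Sum>i\<in>UNIV. a $ i * v $ i) = c})"

definition hyperplane_arrangement :: "('k::field ^ 'n) set set \<Rightarrow> bool" where
  "hyperplane_arrangement A \<longleftrightarrow> finite A \<and> (\<forall>H\<in>A. affine_hyperplane H)"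

definition central :: "'p set set \<Rightarrow> bool" where
  "central A \<longleftrightarrow> \<Inter>A \<noteq> {}"

text \<open>
  Since restrictions are arrangements in a smaller affine space, the following notions take the
  ambient space \<open>V\<close> of an arrangement \<open>A\<close> as an additional argument.  It is the bottom element
  of the intersection poset.
\<close>

definition int_poset :: "'p set \<Rightarrow> 'p set set \<Rightarrow> 'p set set" where
  "int_poset V A = {V \<inter> \<Inter>B | B. B \<subseteq> A} - {{}}"

definition proper_int_poset :: "'p set \<Rightarrow> 'p set set \<Rightarrow> 'p set set" where
  "proper_int_poset V A = int_poset V A - {V}"

definition rk :: "'p set \<Rightarrow> 'p set set \<Rightarrow> 'p set \<Rightarrow> nat" where
  "rk V A x = poset_rank (int_poset V A) V x"

text \<open>All maximal elements of the intersection poset of an arrangement have the same rank.\<close>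

definition arr_rank :: "'p set \<Rightarrow> 'p set set \<Rightarrow> nat" where
  "arr_rank V A = rk V A (SOME x. x \<in> int_poset V A \<and> (\<forall>y\<in>int_poset V A. \<not> y \<subset> x))"

definition top_elem :: "'p set \<Rightarrow> 'p set set \<Rightarrow> 'p set" where
  "top_elem V A = (THE x. x \<in> int_poset V A \<and> (\<forall>y\<in>int_poset V A. x \<subseteq> y))"

definition poincare_poly :: "'p set \<Rightarrow> 'p set set \<Rightarrow> int poly" where
  "poincare_poly V A =
    (\<Sum>x\<in>int_poset V A. smult (moebius (int_poset V A) V x) ((- [:0, 1:]) ^ rk V A x))"

text \<open>The localization \<open>A\<^sub>x\<close> and the restriction \<open>A\<^sup>x\<close>; the ambient space of \<open>A\<^sup>x\<close> is \<open>x\<close>.\<close>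

definition localization :: "'p set set \<Rightarrow> 'p set \<Rightarrow> 'p set set" where
  "localization A x = {H \<in> A. x \<subseteq> H}"

definition restriction :: "'p set set \<Rightarrow> 'p set \<Rightarrow> 'p set set" where
  "restriction A x = {x \<inter> H | H. H \<in> A - localization A x \<and> x \<inter> H \<noteq> {}}"

text \<open>
  The formal symbol \<open>x\<^sub>l\<^sub>+\<^sub>1 = \<emptyset>\<close> is rendered by the empty set: it is not an element of the
  intersection poset, and \<open>localization A {} = A\<close> holds as required.  Thus \<open>xs\<close> below is
  \<open>[x\<^sub>0, x\<^sub>1, \<dots>, x\<^sub>l, x\<^sub>l\<^sub>+\<^sub>1]\<close>.
\<close>

definition flag_poincare_poly :: "'p set \<Rightarrow> 'p set set \<Rightarrow> 'p set list \<Rightarrow> int poly" where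
  "flag_poincare_poly V A F =
    (let xs = V # F @ [{}]
     in \<Prod>k\<le>length F. poincare_poly (xs ! k) (restriction (localization A (xs ! Suc k)) (xs ! k)))"

text \<open>
  The expression \<open>fHP\<^sub>A(y, \<^bold>t)\<close> for elements \<open>y\<close> and \<open>t\<^sub>x\<close> of any field.  The flag
  Hilbert--Poincare series proper is its value at the indeterminates \<open>Y\<close> and \<open>T\<^sub>x\<close> of
  \<open>\<rat>(\<^bold>T)(Y)\<close>; other arguments give the result of substituting them for the indeterminates.
\<close>

definition fHP :: "'p set \<Rightarrow> 'p set set \<Rightarrow> 'f \<Rightarrow> ('p set \<Rightarrow> 'f) \<Rightarrow> 'f::field" where
  "fHP V A y t =
    (\<Sum>F\<in>flags (proper_int_poset V A).
       poly (map_poly of_int (flag_poincare_poly V A F)) y * (\<Prod>x\<in>set F. t x / (1 - t x)))"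

end

theory Submission
  imports Defs
begin

text \<open>
  The intersection poset \<open>L\<close> of a central arrangement is graded by codimension and has a largest
  element \<open>c = \<Inter>A\<close>, and the arrangement \<open>A\<^sub>y\<^sup>x\<close> has the interval \<open>[x,y]\<close> of \<open>L\<close> as its
  intersection poset.  This is all the geometry that the reciprocity uses; the rest takes place in
  the incidence algebra of \<open>L\<close>, with zeta function \<open>\<zeta>\<close>, Moebius function \<open>\<mu>\<close>, and
  \<open>\<rho>\<^sub>s(x,y) = s^r\<close> where \<open>r\<close> is the rank of \<open>[x,y]\<close>.

  Let \<open>\<pi>\<^sub>y(x,w)\<close> be the value at \<open>y\<close> of the Poincare polynomial of \<open>[x,w]\<close> and
  \<open>s = -1/y\<close>.  Writing a dot for the pointwise product, \<open>\<pi>\<^sub>1\<^sub>/\<^sub>y = (\<mu> \<cdot> \<rho>\<^sub>s) * \<zeta>\<close> by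
  definition, and cancelling powers of \<open>y\<close> gives \<open>\<rho>\<^sub>s \<cdot> \<pi>\<^sub>y = \<mu> * \<rho>\<^sub>s\<close>.  As the rank is
  additive, \<open>\<rho>\<^sub>s * (\<mu> \<cdot> \<rho>\<^sub>s) = \<rho>\<^sub>s \<cdot> (\<zeta> * \<mu>) = 1\<close>, so
  \<open>(\<rho>\<^sub>s \<cdot> \<pi>\<^sub>y) * \<pi>\<^sub>1\<^sub>/\<^sub>y = \<mu> * \<zeta> = 1\<close>: inverting \<open>y\<close> amounts, up to a power of
  \<open>-y\<close>, to inverting \<open>\<pi>\<^sub>y\<close> as an element of the incidence algebra
  (\<open>poincare_val_inverse\<close>).

  Let \<open>\<Phi>(x)\<close> be the flag series in which all flags start above \<open>x\<close> instead of above the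
  bottom element, and put \<open>u\<^sub>x = T\<^sub>x/(1 - T\<^sub>x)\<close>.  Splitting off the first element of a flag
  gives \<open>\<Phi>(x) = \<pi>\<^sub>y(x,c) + (\<Sum>z > x. \<pi>\<^sub>y(x,z) u\<^sub>z \<Phi>(z))\<close> (\<open>fHP_below_rec\<close>).  Inverting the
  \<open>T\<^sub>x\<close> replaces \<open>u\<^sub>x\<close> by \<open>-1 - u\<^sub>x\<close>, so that the series \<open>\<Phi>'\<close> with all variables
  inverted satisfies a linear system with matrix \<open>\<pi>\<^sub>1\<^sub>/\<^sub>y\<close>.  Solving that system by means of the
  inverse matrix turns it into the recursion that \<open>\<Phi>\<close> satisfies, up to powers of \<open>s\<close> and
  the factor \<open>T\<^sub>c\<close> (\<open>flag_sum_reciprocity\<close>).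
\<close>

section \<open>The Moebius function on intervals\<close>

text \<open>
  Posets are ordered by reverse inclusion, so \<open>x\<close> is the smallest element of the interval
  \<open>[x,y]\<close> and the largest set in it.
\<close>

definition poset_interval :: "'p set set \<Rightarrow> 'p set \<Rightarrow> 'p set \<Rightarrow> 'p set set" where
  "poset_interval L x y = {z \<in> L. y \<subseteq> z \<and> z \<subseteq> x}"

lemma finite_poset_interval: "finite L \<Longrightarrow> finite (poset_interval L x y)"
  by (simp add: poset_interval_def)

lemma poset_interval_refl: "x \<in> L \<Longrightarrow> poset_interval L x x = {x}"
  by (auto simp: poset_interval_def)

lemma moebius_poset_interval:
  assumes "finite L" "z \<in> poset_interval L x y"
  shows "moebius (poset_interval L x y) x z = moebius L x z"
  using assms(2)
proof (induction "card {w \<in> L. z \<subset> w}" arbitrary: z rule: less_induct)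
  case less
  show ?case
  proof (cases "z = x")
    case True
    then show ?thesis by (simp add: moebius.simps)
  next
    case False
    have z: "z \<in> L" "y \<subseteq> z" "z \<subset> x"
      using less.prems False by (auto simp: poset_interval_def)
    have eq: "{w \<in> poset_interval L x y. z \<subset> w \<and> w \<subseteq> x} = {w \<in> L. z \<subset> w \<and> w \<subseteq> x}"
      using z by (auto simp: poset_interval_def)
    have "moebius (poset_interval L x y) x w = moebius L x w" if "w \<in> {w \<in> L. z \<subset> w \<and> w \<subseteq> x}" for w
    proof (rule less.hyps)
      have "{v \<in> L. w \<subset> v} \<subset> {v \<in> L. z \<subset> v}" using that by auto
      then show "card {v \<in> L. w \<subset> v} < card {v \<in> L. z \<subset> v}"
        using assms(1) by (intro psubset_card_mono) auto
      show "w \<in> poset_interval L x y" using that z by (auto simp: poset_interval_def)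
    qed
    then have "(\<Sum>w\<in>{w \<in> L. z \<subset> w \<and> w \<subseteq> x}. moebius (poset_interval L x y) x w)
        = (\<Sum>w\<in>{w \<in> L. z \<subset> w \<and> w \<subseteq> x}. moebius L x w)"
      by (rule sum.cong[OF refl])
    then show ?thesis
      using False z assms(1) moebius.simps[of "poset_interval L x y" x z] moebius.simps[of L x z]
      by (simp add: eq finite_poset_interval)
  qed
qed

lemma sum_moebius:
  assumes "finite L" "x \<in> L" "y \<in> L" "y \<subseteq> x"
  shows "(\<Sum>z\<in>poset_interval L x y. moebius L x z) = (if x = y then 1 else 0)"
proof (cases "x = y")
  case True
  then show ?thesis using assms by (simp add: poset_interval_refl moebius.simps)
next
  case False
  have "poset_interval L x y = insert y {z \<in> L. y \<subset> z \<and> z \<subseteq> x}"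
    using assms by (auto simp: poset_interval_def)
  then have "(\<Sum>z\<in>poset_interval L x y. moebius L x z)
      = moebius L x y + (\<Sum>z\<in>{z \<in> L. y \<subset> z \<and> z \<subseteq> x}. moebius L x z)"
    using assms(1) by simp
  moreover have "moebius L x y = - (\<Sum>z\<in>{z \<in> L. y \<subset> z \<and> z \<subseteq> x}. moebius L x z)"
    using False assms by (subst moebius.simps) auto
  ultimately show ?thesis using False by simp
qed

text \<open>
  Both sides range over the pairs \<open>x \<le> w \<le> z \<le> y\<close>.  This is what makes convolution in the
  incidence algebra associative.
\<close>

lemma sum_poset_interval_swap:
  assumes "finite L"
  shows "(\<Sum>z\<in>poset_interval L x y. \<Sum>w\<in>poset_interval L x z. F w z)
       = (\<Sum>w\<in>poset_interval L x y. \<Sum>z\<in>poset_interval L w y. F w z)"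
proof -
  have "(\<Sum>z\<in>poset_interval L x y. \<Sum>w\<in>poset_interval L x z. F w z)
      = (\<Sum>(z, w)\<in>(SIGMA z:poset_interval L x y. poset_interval L x z). F w z)"
    using assms by (intro sum.Sigma) (auto simp: finite_poset_interval)
  also have "\<dots> = (\<Sum>(w, z)\<in>(SIGMA w:poset_interval L x y. poset_interval L w y). F w z)"
    by (rule sum.reindex_bij_witness[of _ prod.swap prod.swap]) (auto simp: poset_interval_def)
  also have "\<dots> = (\<Sum>w\<in>poset_interval L x y. \<Sum>z\<in>poset_interval L w y. F w z)"
    using assms by (intro sum.Sigma[symmetric]) (auto simp: finite_poset_interval)
  finally show ?thesis .
qed

text \<open>
  The recursion defining \<open>\<mu>\<close> says that \<open>\<mu>\<close> is a left inverse of \<open>\<zeta>\<close>; here it is shown to be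
  a right inverse as well.  By associativity \<open>\<mu> * (\<zeta> * \<mu>) = \<mu>\<close>, and by induction
  \<open>h = \<zeta> * \<mu>\<close> has the claimed values on all \<open>w > x\<close>, so comparing both sides at \<open>(x,y)\<close>
  leaves only the value at \<open>x\<close>.
\<close>

lemma sum_moebius_left_argument:
  assumes "finite L" "x \<in> L" "y \<in> L" "y \<subseteq> x"
  shows "(\<Sum>z\<in>poset_interval L x y. moebius L z y) = (if x = y then 1 else 0)"
  using assms(2,4)
proof (induction "card (poset_interval L x y)" arbitrary: x rule: less_induct)
  case less
  note x = less.prems
  define h where "h w = (\<Sum>z\<in>poset_interval L w y. moebius L z y)" for w
  have fin: "finite (poset_interval L x y)" using assms(1) by (rule finite_poset_interval)
  have xI: "x \<in> poset_interval L x y" and yI: "y \<in> poset_interval L x y"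
    using x assms(3) by (auto simp: poset_interval_def)
  have hy: "h y = 1" using assms(3) by (simp add: h_def poset_interval_refl moebius.simps)
  have h0: "h w = 0" if "w \<in> poset_interval L x y" "w \<noteq> x" "w \<noteq> y" for w
  proof -
    have "poset_interval L w y \<subset> poset_interval L x y"
      using that x by (auto simp: poset_interval_def)
    then have "card (poset_interval L w y) < card (poset_interval L x y)"
      using fin by (rule psubset_card_mono[rotated])
    moreover have "w \<in> L" "y \<subseteq> w" using that by (auto simp: poset_interval_def)
    ultimately show ?thesis using less.hyps[of w] that by (simp add: h_def)
  qed
  have "(\<Sum>w\<in>poset_interval L x y. moebius L x w * h w)
      = (\<Sum>w\<in>poset_interval L x y. \<Sum>z\<in>poset_interval L w y. moebius L x w * moebius L z y)"
    by (simp add: h_def sum_distrib_left)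
  also have "\<dots> = (\<Sum>z\<in>poset_interval L x y. (\<Sum>w\<in>poset_interval L x z. moebius L x w) * moebius L z y)"
    by (subst sum_poset_interval_swap[OF assms(1), symmetric]) (simp add: sum_distrib_right)
  also have "\<dots> = (\<Sum>z\<in>poset_interval L x y. if z = x then moebius L x y else 0)"
  proof (rule sum.cong[OF refl])
    fix z assume "z \<in> poset_interval L x y"
    then have "z \<in> L" "z \<subseteq> x" by (auto simp: poset_interval_def)
    then show "(\<Sum>w\<in>poset_interval L x z. moebius L x w) * moebius L z y
        = (if z = x then moebius L x y else 0)"
      using sum_moebius[OF assms(1) x(1)] by simp
  qed
  also have "\<dots> = moebius L x y" using fin xI by simp
  finally have *: "(\<Sum>w\<in>poset_interval L x y. moebius L x w * h w) = moebius L x y" .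
  show ?case
  proof (cases "x = y")
    case True
    then show ?thesis using hy by (simp add: h_def)
  next
    case False
    have "(\<Sum>w\<in>poset_interval L x y. moebius L x w * h w) = (\<Sum>w\<in>{x, y}. moebius L x w * h w)"
      using fin xI yI h0 by (intro sum.mono_neutral_right) auto
    also have "\<dots> = h x + moebius L x y"
      using False hy by (simp add: moebius.simps[of L x x])
    finally show ?thesis using * False by (simp add: h_def)
  qed
qed

section \<open>Poincare polynomials of intervals in a graded poset\<close>

text \<open>
  The function \<open>d\<close> plays the role of the dimension: \<open>d_less\<close> bounds the length of every chain
  from \<open>x\<close> to \<open>y\<close> by \<open>d x - d y\<close>, and \<open>d_step\<close> lets one descend in steps of one, so that the
  bound is attained.
\<close>

locale graded_poset =
  fixes L :: "'p set set" and d :: "'p set \<Rightarrow> nat"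
  assumes finite_L: "finite L"
    and d_less: "x \<in> L \<Longrightarrow> y \<in> L \<Longrightarrow> y \<subset> x \<Longrightarrow> d y < d x"
    and d_step: "x \<in> L \<Longrightarrow> y \<in> L \<Longrightarrow> y \<subset> x \<Longrightarrow> \<exists>z\<in>L. y \<subseteq> z \<and> z \<subset> x \<and> d x = Suc (d z)"
begin

abbreviation ivl :: "'p set \<Rightarrow> 'p set \<Rightarrow> 'p set set" where
  "ivl \<equiv> poset_interval L"

lemma d_mono: "x \<in> L \<Longrightarrow> y \<in> L \<Longrightarrow> y \<subseteq> x \<Longrightarrow> d y \<le> d x"
  using d_less[of x y] by (cases "x = y") (simp_all add: psubset_eq less_imp_le)

lemma length_flag_le:
  assumes "set F \<subseteq> L" "sorted_wrt (\<lambda>x y. y \<subset> x) F" "F \<noteq> []"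
  shows "length F + d (last F) \<le> Suc (d (hd F))"
  using assms
proof (induction F)
  case (Cons a F)
  show ?case
  proof (cases "F = []")
    case False
    then have "d (hd F) < d a"
      using Cons.prems hd_in_set[of F] by (intro d_less) auto
    then show ?thesis using Cons False by auto
  qed simp
qed simp

lemma ex_saturated_flag:
  assumes "x \<in> L" "y \<in> L" "y \<subseteq> x"
  shows "\<exists>F. set F \<subseteq> ivl x y \<and> sorted_wrt (\<lambda>x y. y \<subset> x) F \<and> length F = Suc (d x - d y)
      \<and> hd F = x \<and> last F = y"
  using assms
proof (induction "d x" arbitrary: x rule: less_induct)
  case less
  show ?case
  proof (cases "x = y")
    case True
    then show ?thesis using less.prems by (intro exI[of _ "[x]"]) (simp add: poset_interval_def)
  next
    case False
    then obtain z where z: "z \<in> L" "y \<subseteq> z" "z \<subset> x" "d x = Suc (d z)"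
      using d_step less.prems by (metis psubsetI)
    then obtain F where F: "set F \<subseteq> ivl z y" "sorted_wrt (\<lambda>x y. y \<subset> x) F"
        "length F = Suc (d z - d y)" "hd F = z" "last F = y"
      using less.hyps[of z] less.prems by auto
    have "length (x # F) = Suc (d x - d y)"
      using F(3) z d_mono[of z y] less.prems by simp
    moreover have "set (x # F) \<subseteq> ivl x y"
      using F(1) z(3) less.prems by (fastforce simp: poset_interval_def)
    moreover have "sorted_wrt (\<lambda>x y. y \<subset> x) (x # F)"
      using F(1,2) z(3) by (fastforce simp: poset_interval_def)
    moreover have "F \<noteq> []" using F(3) by auto
    ultimately show ?thesis using F(5) by (intro exI[of _ "x # F"]) auto
  qed
qed

text \<open>
  The rank is computed inside an interval because the Poincare polynomial of \<open>A\<^sub>y\<^sup>x\<close> refers to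
  ranks in the intersection poset of \<open>A\<^sub>y\<^sup>x\<close>, not of \<open>A\<close>.
\<close>

lemma poset_rank_eq:
  assumes "x \<in> L" "w \<in> L" "y \<subseteq> w" "w \<subseteq> x"
  shows "poset_rank (ivl x y) x w = d x - d w"
  unfolding poset_rank_def
proof (rule cSup_eq_maximum)
  obtain F where "set F \<subseteq> ivl x w" "sorted_wrt (\<lambda>x y. y \<subset> x) F" "length F = Suc (d x - d w)"
      "hd F = x" "last F = w"
    using ex_saturated_flag assms by blast
  moreover have "ivl x w \<subseteq> ivl x y" using assms by (auto simp: poset_interval_def)
  ultimately show "d x - d w \<in> {k. \<exists>F\<in>flags (ivl x y). length F = Suc k \<and> hd F = x \<and> last F = w}"
    by (auto simp: flags_def intro!: bexI[of _ F])
next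
  fix k
  assume "k \<in> {k. \<exists>F\<in>flags (ivl x y). length F = Suc k \<and> hd F = x \<and> last F = w}"
  then obtain F where "set F \<subseteq> ivl x y" "sorted_wrt (\<lambda>x y. y \<subset> x) F" "length F = Suc k"
      "hd F = x" "last F = w"
    by (auto simp: flags_def)
  then show "k \<le> d x - d w"
    using length_flag_le[of F] by (fastforce simp: poset_interval_def)
qed

text \<open>
  The value at \<open>y\<close> of the Poincare polynomial of the interval \<open>[x,w]\<close>, with Moebius function
  and ranks taken in the whole poset.
\<close>

definition poincare_val :: "'f::field \<Rightarrow> 'p set \<Rightarrow> 'p set \<Rightarrow> 'f" where
  "poincare_val y x w = (\<Sum>z\<in>ivl x w. of_int (moebius L x z) * (- y) ^ (d x - d z))"

lemma poincare_val_refl: "x \<in> L \<Longrightarrow> poincare_val y x x = 1"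
  by (simp add: poincare_val_def poset_interval_refl moebius.simps)

text \<open>
  With \<open>s = -1/y\<close>, the factor \<open>s\<^sup>r\<close> turns \<open>\<pi>\<^sub>y\<close> into \<open>\<mu> * \<rho>\<^sub>s\<close>, and \<open>\<pi>\<^sub>1\<^sub>/\<^sub>y\<close> is
  \<open>(\<mu> \<cdot> \<rho>\<^sub>s) * \<zeta>\<close>.  In the product of the two the middle part \<open>\<rho>\<^sub>s * (\<mu> \<cdot> \<rho>\<^sub>s)\<close> is
  \<open>\<rho>\<^sub>s \<cdot> (\<zeta> * \<mu>) = 1\<close> because ranks add up, and \<open>\<mu> * \<zeta>\<close> remains.
\<close>

lemma poincare_val_inverse:
  fixes y :: "'f::field"
  assumes "y \<noteq> 0" "x \<in> L" "w \<in> L" "w \<subseteq> x"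
  shows "(\<Sum>z\<in>ivl x w. (- inverse y) ^ (d x - d z) * poincare_val y x z * poincare_val (inverse y) z w)
      = (if x = w then 1 else 0)"
proof -
  define s where "s = - inverse y"
  have sy: "s * - y = 1" using assms(1) by (simp add: s_def)
  have L: "z \<in> L" "v \<subseteq> z" "z \<subseteq> u" if "z \<in> ivl u v" for z u v
    using that by (auto simp: poset_interval_def)
  let ?m = "\<lambda>u v. of_int (moebius L u v) :: 'f"
  \<comment> \<open>\<open>\<rho>\<^sub>s \<cdot> \<pi>\<^sub>y = \<mu> * \<rho>\<^sub>s\<close>\<close>
  have f: "s ^ (d x - d z) * poincare_val y x z = (\<Sum>v\<in>ivl x z. ?m x v * s ^ (d v - d z))"
    if "z \<in> ivl x w" for z
  proof -
    have "s ^ (d x - d z) * (- y) ^ (d x - d v) = s ^ (d v - d z)" if "v \<in> ivl x z" for v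
    proof -
      have "d x - d z = (d x - d v) + (d v - d z)"
        using d_mono[of x v] d_mono[of v z] L[OF that] L[OF \<open>z \<in> ivl x w\<close>] assms by simp
      then have "s ^ (d x - d z) * (- y) ^ (d x - d v) = (s * - y) ^ (d x - d v) * s ^ (d v - d z)"
        by (simp only: power_add power_mult_distrib mult_ac)
      then show ?thesis by (simp only: sy) simp
    qed
    then show ?thesis
      unfolding poincare_val_def sum_distrib_left
      by (intro sum.cong) (auto simp: mult.left_commute mult.commute)
  qed
  \<comment> \<open>\<open>\<rho>\<^sub>s * \<pi>\<^sub>1\<^sub>/\<^sub>y = \<rho>\<^sub>s * (\<mu> \<cdot> \<rho>\<^sub>s) * \<zeta> = \<zeta>\<close>\<close>
  have inner: "(\<Sum>z\<in>ivl v w. s ^ (d v - d z) * poincare_val (inverse y) z w) = 1" if v: "v \<in> ivl x w" for v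
  proof -
    have "(\<Sum>z\<in>ivl v w. s ^ (d v - d z) * poincare_val (inverse y) z w)
        = (\<Sum>z\<in>ivl v w. \<Sum>v'\<in>ivl z w. ?m z v' * s ^ (d v - d v'))"
    proof (rule sum.cong[OF refl])
      fix z assume z: "z \<in> ivl v w"
      have "s ^ (d v - d z) * s ^ (d z - d v') = s ^ (d v - d v')" if "v' \<in> ivl z w" for v'
        using d_mono[of v z] d_mono[of z v'] L[OF that] L[OF z] L[OF v]
        by (simp flip: power_add)
      then show "s ^ (d v - d z) * poincare_val (inverse y) z w
          = (\<Sum>v'\<in>ivl z w. ?m z v' * s ^ (d v - d v'))"
        unfolding poincare_val_def sum_distrib_left s_def
        by (intro sum.cong) (auto simp: mult.left_commute)
    qed
    also have "\<dots> = (\<Sum>v'\<in>ivl v w. of_int (\<Sum>z\<in>ivl v v'. moebius L z v') * s ^ (d v - d v'))"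
      by (subst sum_poset_interval_swap[OF finite_L, symmetric]) (simp add: sum_distrib_right)
    also have "\<dots> = (\<Sum>v'\<in>ivl v w. if v' = v then 1 else 0)"
    proof (rule sum.cong[OF refl])
      fix v' assume "v' \<in> ivl v w"
      then show "of_int (\<Sum>z\<in>ivl v v'. moebius L z v') * s ^ (d v - d v') = (if v' = v then 1 else 0)"
        using L[OF v] L[of v' v w] by (subst sum_moebius_left_argument[OF finite_L]) auto
    qed
    also have "\<dots> = 1"
      using L[OF v] finite_L by (auto simp: finite_poset_interval poset_interval_def)
    finally show ?thesis .
  qed
  have "(\<Sum>z\<in>ivl x w. s ^ (d x - d z) * poincare_val y x z * poincare_val (inverse y) z w)
      = (\<Sum>z\<in>ivl x w. \<Sum>v\<in>ivl x z. ?m x v * (s ^ (d v - d z) * poincare_val (inverse y) z w))"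
    by (intro sum.cong) (simp_all add: f sum_distrib_right mult.assoc)
  also have "\<dots> = (\<Sum>v\<in>ivl x w. ?m x v * (\<Sum>z\<in>ivl v w. s ^ (d v - d z) * poincare_val (inverse y) z w))"
    by (subst sum_poset_interval_swap[OF finite_L]) (simp add: sum_distrib_left)
  also have "\<dots> = of_int (\<Sum>v\<in>ivl x w. moebius L x v)"
    by (simp add: inner)
  also have "\<dots> = (if x = w then 1 else 0)"
    using assms by (subst sum_moebius[OF finite_L]) auto
  finally show ?thesis by (simp add: s_def)
qed

section \<open>Reciprocity for sums over flags\<close>

text \<open>
  Put \<open>\<Theta> z = u z * \<Phi>' z\<close>.  Moving everything with coefficient \<open>-1\<close> to the left, the recursion
  for \<open>\<Phi>'\<close> says that the matrix \<open>\<pi>\<^sub>1\<^sub>/\<^sub>y\<close> maps the vector \<open>\<Phi>' + \<Theta> - \<delta>\<^sub>c\<close> to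
  \<open>\<Theta>\<close>.  Its inverse \<open>g(x,z) = s\<^sup>r \<pi>\<^sub>y(x,z)\<close> is unipotent, so for \<open>x \<noteq> c\<close> this yields
  \<open>\<Phi>' x = (\<Sum>z > x. g(x,z) u\<^sub>z \<Phi>' z)\<close>.

  The function that is \<open>1\<close> at \<open>c\<close> and \<open>s^(d x - d c) * t * \<Phi> x\<close> at \<open>x \<noteq> c\<close> satisfies the same
  recursion: after multiplication by \<open>t\<close>, the two terms \<open>\<pi>\<^sub>y(x,c)\<close> and \<open>\<pi>\<^sub>y(x,c) u\<^sub>c\<close> of
  \<open>\<Phi> x\<close> combine into \<open>\<pi>\<^sub>y(x,c) u\<^sub>c\<close>, since \<open>t (1 + u\<^sub>c) = u\<^sub>c\<close>.
\<close>

lemma flag_sum_reciprocity: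
  fixes \<Phi> \<Phi>' u :: "'p set \<Rightarrow> 'f::field"
  assumes y: "y \<noteq> 0" and c: "c \<in> L" "\<And>x. x \<in> L \<Longrightarrow> c \<subseteq> x" and t: "u c = t * (1 + u c)"
    and \<Phi>: "\<And>x. x \<in> L \<Longrightarrow> \<Phi> x = poincare_val y x c
           + (\<Sum>z\<in>{z \<in> L. z \<subset> x}. poincare_val y x z * u z * \<Phi> z)"
    and \<Phi>': "\<And>x. x \<in> L \<Longrightarrow> \<Phi>' x = poincare_val (inverse y) x c
           + (\<Sum>z\<in>{z \<in> L. z \<subset> x}. poincare_val (inverse y) x z * (- 1 - u z) * \<Phi>' z)"
    and x: "x \<in> L" "x \<noteq> c"
  shows "\<Phi>' x = (- inverse y) ^ (d x - d c) * t * \<Phi> x"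
proof -
  define s where "s = - inverse y"
  define \<delta> :: "'p set \<Rightarrow> 'f" where "\<delta> z = (if z = c then 1 else 0)" for z
  define \<Theta> where "\<Theta> z = u z * \<Phi>' z" for z
  let ?f = "poincare_val y" and ?f' = "poincare_val (inverse y)"
  let ?g = "\<lambda>x z. s ^ (d x - d z) * ?f x z"
  have empty: "{z \<in> L. z \<subset> c} = {}" using c(2) by auto
  have \<Phi>c: "\<Phi> c = 1" "\<Phi>' c = 1"
    using \<Phi>[OF c(1)] \<Phi>'[OF c(1)] c(1) by (simp_all only: empty poincare_val_refl) simp_all
  have ivl: "ivl x c = insert x {z \<in> L. z \<subset> x}" if "x \<in> L" for x
    using that c by (auto simp: poset_interval_def)
  have L: "z \<in> L" "v \<subseteq> z" "z \<subseteq> u" if "z \<in> ivl u v" for z u v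
    using that by (auto simp: poset_interval_def)
  have fin: "finite {z \<in> L. z \<subset> x}" "x \<notin> {z \<in> L. z \<subset> x}" for x
    using finite_L by auto
  have \<delta>: "(\<Sum>z\<in>ivl x c. F z * \<delta> z) = F c" if "x \<in> L" for x F
  proof -
    have "(\<Sum>z\<in>ivl x c. F z * \<delta> z) = (\<Sum>z\<in>ivl x c. if z = c then F z else 0)"
      by (intro sum.cong) (auto simp: \<delta>_def)
    also have "\<dots> = F c"
      using that c finite_L by (simp add: finite_poset_interval) (auto simp: poset_interval_def)
    finally show ?thesis .
  qed
  have 1: "(\<Sum>z\<in>ivl x c. ?f' x z * (\<Phi>' z + \<Theta> z - \<delta> z)) = \<Theta> x" if "x \<in> L" for x
  proof -
    have "(\<Sum>z\<in>ivl x c. ?f' x z * (\<Phi>' z + \<Theta> z - \<delta> z))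
        = (\<Sum>z\<in>ivl x c. ?f' x z * (1 + u z) * \<Phi>' z) - (\<Sum>z\<in>ivl x c. ?f' x z * \<delta> z)"
      by (simp add: \<Theta>_def algebra_simps sum.distrib sum_subtractf)
    also have "\<dots> = (1 + u x) * \<Phi>' x + (\<Sum>z\<in>{z \<in> L. z \<subset> x}. ?f' x z * (1 + u z) * \<Phi>' z) - ?f' x c"
      unfolding \<delta>[OF that] unfolding ivl[OF that]
      by (subst sum.insert) (use fin poincare_val_refl[OF that] in auto)
    also have "(\<Sum>z\<in>{z \<in> L. z \<subset> x}. ?f' x z * (1 + u z) * \<Phi>' z)
        = - (\<Sum>z\<in>{z \<in> L. z \<subset> x}. ?f' x z * (- 1 - u z) * \<Phi>' z)"
      unfolding sum_negf[symmetric] by (intro sum.cong) (auto simp: algebra_simps)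
    also have "\<dots> = ?f' x c - \<Phi>' x" using \<Phi>'[OF that] by simp
    finally show ?thesis by (simp add: \<Theta>_def algebra_simps)
  qed
  have 2: "\<Phi>' x + \<Theta> x - \<delta> x = (\<Sum>z\<in>ivl x c. ?g x z * \<Theta> z)" if "x \<in> L" for x
  proof -
    have "(\<Sum>z\<in>ivl x c. ?g x z * \<Theta> z)
        = (\<Sum>z\<in>ivl x c. \<Sum>w\<in>ivl z c. ?g x z * ?f' z w * (\<Phi>' w + \<Theta> w - \<delta> w))"
      by (intro sum.cong) (simp_all add: 1[symmetric] L sum_distrib_left mult.assoc)
    also have "\<dots> = (\<Sum>w\<in>ivl x c. (\<Sum>z\<in>ivl x w. ?g x z * ?f' z w) * (\<Phi>' w + \<Theta> w - \<delta> w))"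
      by (subst sum_poset_interval_swap[OF finite_L, symmetric]) (simp add: sum_distrib_right)
    also have "\<dots> = (\<Sum>w\<in>ivl x c. if w = x then \<Phi>' w + \<Theta> w - \<delta> w else 0)"
      using poincare_val_inverse[OF y that, folded s_def] by (intro sum.cong) (auto simp: L)
    also have "\<dots> = \<Phi>' x + \<Theta> x - \<delta> x"
      using that c finite_L by (simp add: finite_poset_interval) (auto simp: poset_interval_def)
    finally show ?thesis by simp
  qed
  have 3: "\<Phi>' x = (\<Sum>z\<in>{z \<in> L. z \<subset> x}. ?g x z * \<Theta> z)" if "x \<in> L" "x \<noteq> c" for x
  proof -
    have "(\<Sum>z\<in>ivl x c. ?g x z * \<Theta> z) = \<Theta> x + (\<Sum>z\<in>{z \<in> L. z \<subset> x}. ?g x z * \<Theta> z)"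
      unfolding ivl[OF that(1)]
      by (subst sum.insert) (use fin poincare_val_refl[OF that(1)] in auto)
    then show ?thesis using 2[OF that(1)] that(2) by (simp add: \<delta>_def)
  qed
  have split: "{z \<in> L. z \<subset> x} = insert c {z \<in> L. z \<subset> x \<and> z \<noteq> c}" if "x \<in> L" "x \<noteq> c" for x
    using that c by auto
  have fin': "finite {z \<in> L. z \<subset> x \<and> z \<noteq> c}" "c \<notin> {z \<in> L. z \<subset> x \<and> z \<noteq> c}" for x
    using finite_L by auto
  have "\<Phi>' x = s ^ (d x - d c) * (t * \<Phi> x)" using x
  proof (induction "d x" arbitrary: x rule: less_induct)
    case less
    note x = less.prems
    have "s ^ (d x - d c) * (t * \<Phi> x)
        = s ^ (d x - d c) * (?f x c * (t * (1 + u c))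
          + (\<Sum>z\<in>{z \<in> L. z \<subset> x \<and> z \<noteq> c}. ?f x z * u z * (t * \<Phi> z)))"
      unfolding \<Phi>[OF x(1)] split[OF x] sum.insert[OF fin'] \<Phi>c
      by (simp add: algebra_simps sum_distrib_left)
    also have "\<dots> = ?g x c * \<Theta> c
          + (\<Sum>z\<in>{z \<in> L. z \<subset> x \<and> z \<noteq> c}. s ^ (d x - d c) * (?f x z * u z * (t * \<Phi> z)))"
      unfolding t[symmetric] by (simp add: \<Theta>_def \<Phi>c distrib_left sum_distrib_left)
    also have "(\<Sum>z\<in>{z \<in> L. z \<subset> x \<and> z \<noteq> c}. s ^ (d x - d c) * (?f x z * u z * (t * \<Phi> z)))
        = (\<Sum>z\<in>{z \<in> L. z \<subset> x \<and> z \<noteq> c}. ?g x z * \<Theta> z)"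
    proof (rule sum.cong[OF refl])
      fix z assume z: "z \<in> {z \<in> L. z \<subset> x \<and> z \<noteq> c}"
      have "d x - d c = (d x - d z) + (d z - d c)"
        using d_mono[of x z] d_mono[of z c] z x c by auto
      moreover have "\<Phi>' z = s ^ (d z - d c) * (t * \<Phi> z)"
        using z x by (intro less.hyps d_less) auto
      ultimately show "s ^ (d x - d c) * (?f x z * u z * (t * \<Phi> z)) = ?g x z * \<Theta> z"
        by (simp add: \<Theta>_def power_add mult_ac)
    qed
    also have "?g x c * \<Theta> c + (\<Sum>z\<in>{z \<in> L. z \<subset> x \<and> z \<noteq> c}. ?g x z * \<Theta> z)
        = (\<Sum>z\<in>{z \<in> L. z \<subset> x}. ?g x z * \<Theta> z)"
      unfolding split[OF x] using fin' by simp
    also have "\<dots> = \<Phi>' x" using 3[OF x] by simp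
    finally show ?case by simp
  qed
  then show ?thesis by (simp add: s_def mult.assoc)
qed

end

section \<open>Intersection posets of central arrangements\<close>

lemma int_poset_central:
  assumes "central A"
  shows "int_poset UNIV A = Inter ` Pow A"
proof -
  have "\<Inter>B \<noteq> {}" if "B \<subseteq> A" for B
    using assms Inter_anti_mono[OF that] by (auto simp: central_def)
  then show ?thesis unfolding int_poset_def Pow_def image_def by auto
qed

text \<open>
  An element \<open>z = \<Inter>C\<close> of \<open>[x,y]\<close> is cut out of \<open>x\<close> by the hyperplanes in \<open>C\<close> that do not
  contain \<open>x\<close>, and all of \<open>C\<close> contains \<open>y\<close>.  Since \<open>y\<close> is nonempty, none of the
  intersections involved is empty.
\<close>

lemma int_poset_restriction:
  assumes "central A" "x \<in> int_poset UNIV A" and y: "y \<in> int_poset UNIV A" "y \<subseteq> x"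
  shows "int_poset x (restriction (localization A y) x) = poset_interval (int_poset UNIV A) x y"
proof (intro equalityI subsetI)
  obtain Bx where Bx: "Bx \<subseteq> A" "x = \<Inter>Bx" using assms by (auto simp: int_poset_central)
  obtain By where By: "By \<subseteq> A" "y = \<Inter>By" using assms by (auto simp: int_poset_central)
  have y_ne: "y \<noteq> {}" using y by (auto simp: int_poset_def)
  fix z
  {
    assume "z \<in> int_poset x (restriction (localization A y) x)"
    then obtain B where B: "B \<subseteq> restriction (localization A y) x" "z = x \<inter> \<Inter>B"
      by (auto simp: int_poset_def)
    define C where "C = {H \<in> localization A y. x \<inter> H \<in> B}"
    have "x \<inter> \<Inter>B = x \<inter> \<Inter>C"
    proof -
      have "v \<in> K" if "v \<in> x" "v \<in> \<Inter>C" "K \<in> B" for v K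
      proof -
        obtain H where H: "K = x \<inter> H" "H \<in> localization A y"
          using B(1) \<open>K \<in> B\<close> by (auto simp: restriction_def)
        then have "H \<in> C" using \<open>K \<in> B\<close> by (simp add: C_def)
        then show ?thesis using that H by auto
      qed
      then show ?thesis by (auto simp: C_def)
    qed
    then have "z = \<Inter>(Bx \<union> C)"
      using B(2) by (simp add: Bx(2)[symmetric] Inter_Un_distrib)
    moreover have "Bx \<union> C \<subseteq> A" using Bx by (auto simp: C_def localization_def)
    moreover have "y \<subseteq> K" if "K \<in> B" for K
      using B(1) \<open>y \<subseteq> x\<close> that by (auto simp: restriction_def localization_def)
    then have "y \<subseteq> z" "z \<subseteq> x"
      using B(2) \<open>y \<subseteq> x\<close> by auto
    ultimately show "z \<in> poset_interval (int_poset UNIV A) x y"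
      unfolding poset_interval_def int_poset_central[OF assms(1)] by blast
  next
    assume "z \<in> poset_interval (int_poset UNIV A) x y"
    then obtain C where C: "C \<subseteq> A" "z = \<Inter>C" "y \<subseteq> z" "z \<subseteq> x"
      using assms(1) by (auto simp: poset_interval_def int_poset_central)
    define B where "B = {x \<inter> H | H. H \<in> C \<and> \<not> x \<subseteq> H}"
    have "B \<subseteq> restriction (localization A y) x"
    proof
      fix K assume "K \<in> B"
      then obtain H where H: "K = x \<inter> H" "H \<in> C" "\<not> x \<subseteq> H" by (auto simp: B_def)
      then have "H \<in> A" "y \<subseteq> H" using C by auto
      then have "H \<in> localization A y - localization (localization A y) x" "x \<inter> H \<noteq> {}"
        using H(3) y_ne y(2) by (auto simp: localization_def)
      then show "K \<in> restriction (localization A y) x"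
        using H(1) by (auto simp: restriction_def)
    qed
    moreover have "z = x \<inter> \<Inter>B"
    proof
      show "z \<subseteq> x \<inter> \<Inter>B" using C by (auto simp: B_def)
      show "x \<inter> \<Inter>B \<subseteq> z"
      proof
        fix v assume v: "v \<in> x \<inter> \<Inter>B"
        have "v \<in> H" if "H \<in> C" for H
          using v that by (cases "x \<subseteq> H") (auto simp: B_def)
        then show "v \<in> z" using C(2) by simp
      qed
    qed
    moreover have "z \<noteq> {}" using C y_ne by auto
    ultimately show "z \<in> int_poset x (restriction (localization A y) x)"
      unfolding int_poset_def by blast
  }
qed

lemma linear_form_add:
  fixes a :: "'k::field ^ 'n"
  shows "(\<Sum>i\<in>UNIV. a $ i * (v + w) $ i) = (\<Sum>i\<in>UNIV. a $ i * v $ i) + (\<Sum>i\<in>UNIV. a $ i * w $ i)"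
  by (simp add: distrib_left sum.distrib)

lemma linear_form_scale:
  fixes a :: "'k::field ^ 'n"
  shows "(\<Sum>i\<in>UNIV. a $ i * (c *s w) $ i) = c * (\<Sum>i\<in>UNIV. a $ i * w $ i)"
  by (simp add: sum_distrib_left mult.left_commute)

text \<open>
  If \<open>v\<close> lies off the hyperplane, then every vector of \<open>S\<close> is a multiple of \<open>v\<close> plus a vector
  of the section, so the dimension drops by at most one.  It does drop, as the section is a proper
  subspace.
\<close>

lemma dim_hyperplane_section:
  fixes a :: "'k::field ^ 'n"
  assumes S: "vec.subspace S" and v: "v \<in> S" "(\<Sum>i\<in>UNIV. a $ i * v $ i) \<noteq> 0"
  shows "vec.dim S = Suc (vec.dim {w \<in> S. (\<Sum>i\<in>UNIV. a $ i * w $ i) = 0})"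
proof -
  define \<phi> where "\<phi> w = (\<Sum>i\<in>UNIV. a $ i * w $ i)" for w
  have \<phi>_add: "\<phi> (w + w') = \<phi> w + \<phi> w'" for w w'
    unfolding \<phi>_def by (rule linear_form_add)
  have \<phi>_scale: "\<phi> (c *s w) = c * \<phi> w" for c w
    unfolding \<phi>_def by (rule linear_form_scale)
  define K where "K = {w \<in> S. \<phi> w = 0}"
  have "vec.subspace K"
    using S \<phi>_scale[of 0] unfolding vec.subspace_def K_def by (auto simp: \<phi>_add \<phi>_scale)
  moreover have "K \<subset> S" using v by (auto simp: K_def \<phi>_def)
  ultimately have "vec.dim K < vec.dim S"
    using S by (intro vec.dim_psubset) (simp only: vec.span_eq_iff[THEN iffD2])
  moreover have "vec.dim S \<le> Suc (vec.dim K)"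
  proof -
    have "S \<subseteq> vec.span (insert v K)"
    proof
      fix w assume w: "w \<in> S"
      define k where "k = \<phi> w / \<phi> v"
      have "\<phi> (w + (- k) *s v) = 0"
        unfolding \<phi>_add \<phi>_scale using v(2) by (simp add: k_def \<phi>_def)
      then have "w - k *s v \<in> K"
        using w v(1) S vec.subspace_diff[OF S w vec.subspace_scale[OF S v(1)], of k]
        by (simp add: K_def vec.scale_minus_left)
      then show "w \<in> vec.span (insert v K)"
        unfolding vec.span_breakdown_eq using vec.span_base by blast
    qed
    then have "vec.dim S \<le> vec.dim (insert v K)"
      by (metis vec.dim_span vec.dim_subset)
    also have "\<dots> \<le> Suc (vec.dim K)" by (simp add: vec.dim_insert)
    finally show ?thesis .
  qed
  ultimately show ?thesis unfolding K_def \<phi>_def by simp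
qed

lemma hyperplane_through:
  assumes "affine_hyperplane H" "p \<in> H"
  obtains a where "a \<noteq> 0" "\<And>w. p + w \<in> H \<longleftrightarrow> (\<Sum>i\<in>UNIV. a $ i * w $ i) = 0"
proof -
  obtain a c where a: "a \<noteq> 0" "H = {v. (\<Sum>i\<in>UNIV. a $ i * v $ i) = c}"
    using assms(1) by (auto simp: affine_hyperplane_def)
  have "p + w \<in> H \<longleftrightarrow> (\<Sum>i\<in>UNIV. a $ i * w $ i) = 0" for w
    using assms(2) unfolding a(2) mem_Collect_eq linear_form_add by simp
  with a(1) show ?thesis by (rule that)
qed

text \<open>
  Moving a common point \<open>p\<close> of all hyperplanes to the origin turns the elements of the intersection
  poset into linear subspaces.  If \<open>y \<subset> x\<close>, some hyperplane \<open>H \<supseteq> y\<close> of the arrangement does not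
  contain \<open>x\<close>, and \<open>x \<inter> H\<close> is the required step from \<open>x\<close> towards \<open>y\<close>.
\<close>

lemma graded_poset_central_arrangement:
  fixes A :: "('k::field ^ 'n) set set"
  assumes A: "hyperplane_arrangement A" and p: "p \<in> \<Inter>A"
  shows "graded_poset (int_poset UNIV A) (\<lambda>x. vec.dim {w. p + w \<in> x})"
proof
  have L: "int_poset UNIV A = Inter ` Pow A"
    using p by (intro int_poset_central) (auto simp: central_def)
  show "finite (int_poset UNIV A)"
    using A by (simp add: L hyperplane_arrangement_def)
  have sub: "vec.subspace {w. p + w \<in> x}" if x: "x \<in> int_poset UNIV A" for x
  proof -
    obtain B where B: "B \<subseteq> A" "x = \<Inter>B" using x by (auto simp: L)
    have "vec.subspace {w. p + w \<in> H}" if H: "H \<in> B" for H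
    proof -
      have "affine_hyperplane H" "p \<in> H"
        using A p H B by (auto simp: hyperplane_arrangement_def)
      then obtain a where a: "\<And>w. p + w \<in> H \<longleftrightarrow> (\<Sum>i\<in>UNIV. a $ i * w $ i) = 0"
        using hyperplane_through by blast
      show ?thesis
        unfolding vec.subspace_def mem_Collect_eq a linear_form_add linear_form_scale by simp
    qed
    then show ?thesis unfolding B(2) vec.subspace_def by auto
  qed
  show "vec.dim {w. p + w \<in> y} < vec.dim {w. p + w \<in> x}"
    if "x \<in> int_poset UNIV A" "y \<in> int_poset UNIV A" "y \<subset> x" for x y
  proof (rule vec.dim_psubset)
    obtain v where "v \<in> x" "v \<notin> y" using \<open>y \<subset> x\<close> by auto
    then have "v - p \<in> {w. p + w \<in> x}" "v - p \<notin> {w. p + w \<in> y}" by simp_all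
    moreover have "{w. p + w \<in> y} \<subseteq> {w. p + w \<in> x}" using \<open>y \<subset> x\<close> by auto
    ultimately have "{w. p + w \<in> y} \<subset> {w. p + w \<in> x}" by blast
    then show "vec.span {w. p + w \<in> y} \<subset> vec.span {w. p + w \<in> x}"
      using sub that by (simp only: vec.span_eq_iff[THEN iffD2])
  qed
  show "\<exists>z\<in>int_poset UNIV A. y \<subseteq> z \<and> z \<subset> x \<and> vec.dim {w. p + w \<in> x} = Suc (vec.dim {w. p + w \<in> z})"
    if x: "x \<in> int_poset UNIV A" and y: "y \<in> int_poset UNIV A" and yx: "y \<subset> x" for x y
  proof -
    obtain Bx where Bx: "Bx \<subseteq> A" "x = \<Inter>Bx" using x by (auto simp: L)
    obtain By where By: "By \<subseteq> A" "y = \<Inter>By" using y by (auto simp: L)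
    obtain H where H: "H \<in> By" "\<not> x \<subseteq> H" using yx By(2) by auto
    have "affine_hyperplane H" "p \<in> H"
      using A p H By by (auto simp: hyperplane_arrangement_def)
    then obtain a where a: "\<And>w. p + w \<in> H \<longleftrightarrow> (\<Sum>i\<in>UNIV. a $ i * w $ i) = 0"
      using hyperplane_through by blast
    obtain v where v: "v \<in> x" "v \<notin> H" using H(2) by auto
    have "vec.dim {w. p + w \<in> x}
        = Suc (vec.dim {w \<in> {w. p + w \<in> x}. (\<Sum>i\<in>UNIV. a $ i * w $ i) = 0})"
    proof (rule dim_hyperplane_section[OF sub[OF x]])
      show "v - p \<in> {w. p + w \<in> x}" using v by simp
      show "(\<Sum>i\<in>UNIV. a $ i * (v - p) $ i) \<noteq> 0" using v(2) unfolding a[symmetric] by simp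
    qed
    also have "{w \<in> {w. p + w \<in> x}. (\<Sum>i\<in>UNIV. a $ i * w $ i) = 0} = {w. p + w \<in> x \<inter> H}"
      by (auto simp: a)
    finally have "vec.dim {w. p + w \<in> x} = Suc (vec.dim {w. p + w \<in> x \<inter> H})" .
    moreover have "x \<inter> H = \<Inter>(insert H Bx)" using Bx by auto
    then have "x \<inter> H \<in> int_poset UNIV A" using Bx By H unfolding L by blast
    moreover have "y \<subseteq> x \<inter> H" "x \<inter> H \<subset> x" using yx By(2) H by auto
    ultimately show ?thesis by blast
  qed
qed

lemma hyperplane_neq_UNIV:
  fixes H :: "('k::field ^ 'n) set"
  assumes "affine_hyperplane H"
  shows "H \<noteq> UNIV"
proof
  assume "H = UNIV"
  then have "0 \<in> H" by simp
  with assms obtain a where a: "a \<noteq> 0" "\<And>w. 0 + w \<in> H \<longleftrightarrow> (\<Sum>i\<in>UNIV. a $ i * w $ i) = 0"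
    using hyperplane_through by blast
  obtain j where "a $ j \<noteq> 0" using a(1) by (auto simp: vec_eq_iff)
  have "(\<Sum>i\<in>UNIV. a $ i * axis j 1 $ i) = (\<Sum>i\<in>UNIV. if i = j then a $ i else 0)"
    by (intro sum.cong) (auto simp: axis_def)
  also have "\<dots> = a $ j" by simp
  finally show False using a(2)[of "axis j 1"] \<open>a $ j \<noteq> 0\<close> \<open>H = UNIV\<close> by simp
qed

section \<open>The flag Hilbert-Poincare series as a sum over flags of intervals\<close>

lemma poly_of_int_add:
  "poly (map_poly of_int (p + q)) (y :: 'f::field) = poly (map_poly of_int p) y + poly (map_poly of_int q) y"
proof -
  have "map_poly of_int (p + q) = (map_poly of_int p + map_poly of_int q :: 'f poly)"
    by (rule poly_eqI) (simp add: coeff_map_poly)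
  then show ?thesis by simp
qed

lemma poly_of_int_mult:
  "poly (map_poly of_int (p * q)) (y :: 'f::field) = poly (map_poly of_int p) y * poly (map_poly of_int q) y"
proof -
  have "map_poly of_int (p * q) = (map_poly of_int p * map_poly of_int q :: 'f poly)"
    by (rule poly_eqI) (simp add: coeff_map_poly coeff_mult)
  then show ?thesis by simp
qed

lemma poly_of_int_sum:
  "poly (map_poly of_int (\<Sum>x\<in>S. p x)) (y :: 'f::field) = (\<Sum>x\<in>S. poly (map_poly of_int (p x)) y)"
  by (induction S rule: infinite_finite_induct) (simp_all add: poly_of_int_add)

lemma poly_of_int_monomial:
  "poly (map_poly of_int (smult c ((- [:0, 1:]) ^ n))) (y :: 'f::field) = of_int c * (- y) ^ n"
proof -
  have "poly (map_poly of_int ((- [:0, 1:]) ^ n)) y = (- y) ^ n"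
  proof (induction n)
    case (Suc n)
    then show ?case by (simp only: power_Suc poly_of_int_mult) (simp add: map_poly_pCons)
  qed simp
  moreover have "smult c q = [:c:] * q" for q by simp
  ultimately show ?thesis by (simp only: poly_of_int_mult) (simp add: map_poly_pCons)
qed

text \<open>
  Moebius function and rank of \<open>A\<^sub>w\<^sup>x\<close> are those of the interval \<open>[x,w]\<close>, and both can be read off
  in the whole poset.
\<close>

lemma poly_poincare_poly_interval:
  fixes y :: "'f::field"
  assumes "graded_poset (int_poset UNIV A) d" "central A"
    and x: "x \<in> int_poset UNIV A" and w: "w \<in> int_poset UNIV A" "w \<subseteq> x"
  shows "poly (map_poly of_int (poincare_poly x (restriction (localization A w) x))) y
       = graded_poset.poincare_val (int_poset UNIV A) d y x w"
proof -
  interpret graded_poset "int_poset UNIV A" d by fact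
  have "moebius (ivl x w) x z = moebius (int_poset UNIV A) x z" "poset_rank (ivl x w) x z = d x - d z"
    if "z \<in> ivl x w" for z
  proof -
    show "moebius (ivl x w) x z = moebius (int_poset UNIV A) x z"
      using finite_L that by (rule moebius_poset_interval)
    show "poset_rank (ivl x w) x z = d x - d z"
      using that by (intro poset_rank_eq) (auto simp: x poset_interval_def)
  qed
  then show ?thesis
    unfolding poincare_poly_def rk_def int_poset_restriction[OF assms(2) x w]
      poly_of_int_sum poly_of_int_monomial poincare_val_def
    by (intro sum.cong) simp_all
qed

lemma flags_below_Cons:
  "flags {z \<in> L. z \<subset> x} = insert [] (\<Union>z\<in>{z \<in> L. z \<subset> x}. Cons z ` flags {w \<in> L. w \<subset> z})"
proof (intro equalityI subsetI)
  fix F assume "F \<in> flags {z \<in> L. z \<subset> x}"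
  then show "F \<in> insert [] (\<Union>z\<in>{z \<in> L. z \<subset> x}. Cons z ` flags {w \<in> L. w \<subset> z})"
  proof (cases F)
    case (Cons z G)
    then have "z \<in> {z \<in> L. z \<subset> x}" "G \<in> flags {w \<in> L. w \<subset> z}"
      using \<open>F \<in> flags {z \<in> L. z \<subset> x}\<close> by (simp_all add: flags_def subset_iff)
    then show ?thesis using Cons by blast
  qed simp
next
  fix F assume "F \<in> insert [] (\<Union>z\<in>{z \<in> L. z \<subset> x}. Cons z ` flags {w \<in> L. w \<subset> z})"
  then show "F \<in> flags {z \<in> L. z \<subset> x}"
    by (fastforce simp: flags_def)
qed

lemma flag_distinct:
  assumes "F \<in> flags P"
  shows "distinct F"
proof -
  have "sorted_wrt (\<noteq>) F"
    using assms unfolding flags_def by (auto intro: sorted_wrt_mono_rel[of F "\<lambda>x y. y \<subset> x"])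
  then show ?thesis by (simp add: distinct_conv_nth sorted_wrt_iff_nth_less) (metis nat_neq_iff)
qed

lemma finite_flags:
  assumes "finite P"
  shows "finite (flags P)"
proof (rule finite_subset)
  show "flags P \<subseteq> {F. set F \<subseteq> P \<and> distinct F}"
    using flag_distinct by (auto simp: flags_def)
  show "finite {F. set F \<subseteq> P \<and> distinct F}"
    using assms by (rule finite_subset_distinct)
qed

lemma sum_flags_below:
  assumes "finite L"
  shows "(\<Sum>F\<in>flags {z \<in> L. z \<subset> x}. g F)
       = g [] + (\<Sum>z\<in>{z \<in> L. z \<subset> x}. \<Sum>F\<in>flags {w \<in> L. w \<subset> z}. g (z # F))"
proof -
  have fin: "finite (flags {w \<in> L. w \<subset> z})" for z
    using assms by (intro finite_flags) simp
  have "(\<Sum>F\<in>flags {z \<in> L. z \<subset> x}. g F)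
      = g [] + (\<Sum>F\<in>(\<Union>z\<in>{z \<in> L. z \<subset> x}. Cons z ` flags {w \<in> L. w \<subset> z}). g F)"
    unfolding flags_below_Cons[of L x] using assms fin by (subst sum.insert) auto
  also have "(\<Sum>F\<in>(\<Union>z\<in>{z \<in> L. z \<subset> x}. Cons z ` flags {w \<in> L. w \<subset> z}). g F)
      = (\<Sum>z\<in>{z \<in> L. z \<subset> x}. \<Sum>F\<in>Cons z ` flags {w \<in> L. w \<subset> z}. g F)"
    using assms fin by (intro sum.UNION_disjoint) auto
  also have "\<dots> = (\<Sum>z\<in>{z \<in> L. z \<subset> x}. \<Sum>F\<in>flags {w \<in> L. w \<subset> z}. g (z # F))"
    by (simp add: sum.reindex inj_on_def)
  finally show ?thesis .
qed

lemma flag_poincare_poly_Cons: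
  "flag_poincare_poly x A (z # F)
     = poincare_poly x (restriction (localization A z) x) * flag_poincare_poly z A F"
  by (simp add: flag_poincare_poly_def Let_def prod.atMost_Suc_shift del: prod.atMost_Suc)

text \<open>
  The flag series with the initial element \<open>x\<^sub>0 = x\<close> in place of the bottom element; the recursion
  over the first element of a flag leads outside the case \<open>x\<^sub>0 = UNIV\<close>.
\<close>

definition fHP_below :: "'p set set \<Rightarrow> 'f::field \<Rightarrow> ('p set \<Rightarrow> 'f) \<Rightarrow> 'p set \<Rightarrow> 'f" where
  "fHP_below A y t x =
    (\<Sum>F\<in>flags {z \<in> int_poset UNIV A. z \<subset> x}.
       poly (map_poly of_int (flag_poincare_poly x A F)) y * (\<Prod>z\<in>set F. t z / (1 - t z)))"

lemma fHP_eq_fHP_below: "fHP UNIV A y t = fHP_below A y t UNIV"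
proof -
  have "proper_int_poset UNIV A = {z \<in> int_poset UNIV A. z \<subset> UNIV}"
    by (auto simp: proper_int_poset_def)
  then show ?thesis by (simp add: fHP_def fHP_below_def)
qed

text \<open>
  The term \<open>\<pi>\<^sub>y(x, \<Inter>A)\<close> comes from the empty flag: localizing at the formal symbol, the empty set,
  gives \<open>A\<close>, and so does localizing at \<open>\<Inter>A\<close>.
\<close>

lemma fHP_below_rec:
  fixes y :: "'f::field"
  assumes "graded_poset (int_poset UNIV A) d" "central A" and x: "x \<in> int_poset UNIV A"
  shows "fHP_below A y t x = graded_poset.poincare_val (int_poset UNIV A) d y x (\<Inter>A)
    + (\<Sum>z\<in>{z \<in> int_poset UNIV A. z \<subset> x}. graded_poset.poincare_val (int_poset UNIV A) d y x z
         * (t z / (1 - t z)) * fHP_below A y t z)"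
proof -
  interpret graded_poset "int_poset UNIV A" d by fact
  let ?L = "int_poset UNIV A"
  have c: "\<Inter>A \<in> ?L" "\<Inter>A \<subseteq> x"
    using x unfolding int_poset_central[OF assms(2)] by auto
  let ?g = "\<lambda>x F. poly (map_poly of_int (flag_poincare_poly x A F)) y * (\<Prod>z\<in>set F. t z / (1 - t z))"
  have "localization A {} = localization A (\<Inter>A)"
    by (auto simp: localization_def)
  then have nil: "?g x [] = poincare_val y x (\<Inter>A)"
    using poly_poincare_poly_interval[OF assms c(1) c(2), of y] by (simp add: flag_poincare_poly_def)
  have cons: "(\<Sum>F\<in>flags {w \<in> ?L. w \<subset> z}. ?g x (z # F))
      = poincare_val y x z * (t z / (1 - t z)) * fHP_below A y t z" if z: "z \<in> {z \<in> ?L. z \<subset> x}" for z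
  proof -
    have zx: "z \<in> ?L" "z \<subseteq> x" using z by auto
    have "?g x (z # F) = poincare_val y x z * (t z / (1 - t z)) * ?g z F"
      if F: "F \<in> flags {w \<in> ?L. w \<subset> z}" for F
    proof -
      have "z \<notin> set F" using F by (auto simp: flags_def)
      then show ?thesis
        using poly_poincare_poly_interval[OF assms zx, of y]
        by (simp add: flag_poincare_poly_Cons poly_of_int_mult mult_ac)
    qed
    then show ?thesis by (simp add: fHP_below_def sum_distrib_left)
  qed
  have "fHP_below A y t x
      = ?g x [] + (\<Sum>z\<in>{z \<in> ?L. z \<subset> x}. \<Sum>F\<in>flags {w \<in> ?L. w \<subset> z}. ?g x (z # F))"
    unfolding fHP_below_def by (rule sum_flags_below[OF finite_L])
  also have "\<dots> = poincare_val y x (\<Inter>A)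
      + (\<Sum>z\<in>{z \<in> ?L. z \<subset> x}. poincare_val y x z * (t z / (1 - t z)) * fHP_below A y t z)"
    unfolding nil by (intro arg_cong2[where f = "(+)"] sum.cong refl cons)
  finally show ?thesis .
qed

text \<open>
  The identity holds for arbitrary field elements in place of the indeterminates, as long as both
  sides are defined.
\<close>

lemma fHP_reciprocity:
  fixes A :: "('k::field ^ 'n) set set" and y :: "'f::field"
  assumes A: "hyperplane_arrangement A" "A \<noteq> {}" "central A"
    and y: "y \<noteq> 0" and t: "\<And>x. t x \<noteq> 0" "\<And>x. t x \<noteq> 1"
  shows "fHP UNIV A (inverse y) (\<lambda>x. inverse (t x)) =
    (- y) powi (- int (arr_rank UNIV A)) * t (top_elem UNIV A) * fHP UNIV A y t"
proof -
  obtain p where p: "p \<in> \<Inter>A" using A(3) by (auto simp: central_def)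
  define d where "d = (\<lambda>x. vec.dim {w. p + w \<in> x})"
  have graded: "graded_poset (int_poset UNIV A) d"
    unfolding d_def by (rule graded_poset_central_arrangement[OF A(1) p])
  then interpret graded_poset "int_poset UNIV A" d .
  let ?L = "int_poset UNIV A" and ?c = "\<Inter>A"
  have L: "?L = Inter ` Pow A" using A(3) by (rule int_poset_central)
  have c: "?c \<in> ?L" "\<And>x. x \<in> ?L \<Longrightarrow> ?c \<subseteq> x"
    unfolding L by auto
  have UNIV: "UNIV \<in> ?L" unfolding L by (rule image_eqI[of _ _ "{}"]) auto
  have "UNIV \<noteq> ?c"
    using A(1,2) hyperplane_neq_UNIV by (fastforce simp: hyperplane_arrangement_def)
  have u: "inverse (t x) / (1 - inverse (t x)) = - 1 - t x / (1 - t x)" for x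
    using t[of x] by (simp add: field_simps)
  have "fHP_below A (inverse y) (\<lambda>x. inverse (t x)) UNIV
      = (- inverse y) ^ (d UNIV - d ?c) * t ?c * fHP_below A y t UNIV"
  proof (rule flag_sum_reciprocity[OF y c(1), where u = "\<lambda>x. t x / (1 - t x)"])
    show "t ?c / (1 - t ?c) = t ?c * (1 + t ?c / (1 - t ?c))"
      using t(2)[of ?c] by (simp add: field_simps)
    show "fHP_below A y t x = poincare_val y x ?c
        + (\<Sum>z\<in>{z \<in> ?L. z \<subset> x}. poincare_val y x z * (t z / (1 - t z)) * fHP_below A y t z)"
      if "x \<in> ?L" for x
      using graded A(3) that by (rule fHP_below_rec)
    show "fHP_below A (inverse y) (\<lambda>x. inverse (t x)) x = poincare_val (inverse y) x ?c
        + (\<Sum>z\<in>{z \<in> ?L. z \<subset> x}. poincare_val (inverse y) x z * (- 1 - t z / (1 - t z))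
             * fHP_below A (inverse y) (\<lambda>x. inverse (t x)) z)"
      if "x \<in> ?L" for x
      unfolding u[symmetric] using graded A(3) that by (rule fHP_below_rec)
  qed (use c(2) UNIV \<open>UNIV \<noteq> ?c\<close> in simp_all)
  moreover have "top_elem UNIV A = ?c"
    unfolding top_elem_def by (rule the_equality) (use c in \<open>simp_all add: subset_antisym\<close>)
  moreover have "arr_rank UNIV A = d UNIV - d ?c"
  proof -
    have "(SOME x. x \<in> ?L \<and> (\<forall>y\<in>?L. \<not> y \<subset> x)) = ?c"
      by (rule some_equality) (use c in \<open>metis psubset_subset_trans psubset_eq\<close>)+
    moreover have "?L = ivl UNIV ?c" using c by (auto simp: poset_interval_def)
    then have "poset_rank ?L UNIV ?c = d UNIV - d ?c"
      using poset_rank_eq[of UNIV ?c ?c] c UNIV by simp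
    ultimately show ?thesis by (simp add: arr_rank_def rk_def)
  qed
  moreover have "(- y) powi (- int n) = (- inverse y) ^ n" for n
    by (simp add: power_int_minus flip: power_inverse)
  ultimately show ?thesis by (simp add: fHP_eq_fHP_below)
qed

lemma indet_neq: "indet v \<noteq> 0" "indet v \<noteq> 1"
proof -
  have X: "Poly_Mapping.single v (1 :: nat) \<noteq> 0"
    by (metis lookup_single_eq lookup_zero zero_neq_one)
  show "indet v \<noteq> 0"
    by transfer (metis lookup_single_eq lookup_zero zero_neq_one)
  have "Poly_Mapping.lookup (Poly_Mapping.single (Poly_Mapping.single v (1 :: nat)) (1 :: rat)) 0
      \<noteq> Poly_Mapping.lookup 1 0"
    using X by (simp add: lookup_single when_def lookup_one)
  then have "Poly_Mapping.single (Poly_Mapping.single v (1 :: nat)) (1 :: rat) \<noteq> 1"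
    by metis
  then show "indet v \<noteq> 1"
    by transfer
qed

theorem theorem1:
  fixes A :: "('k::field_char_0 ^ 'n) set set"
    and Y :: "('k ^ 'n) set ratfun"
    and T :: "('k ^ 'n) set \<Rightarrow> ('k ^ 'n) set ratfun"
  defines "Y \<equiv> indet_Y" and "T \<equiv> indet_T"
  assumes "hyperplane_arrangement A" and "A \<noteq> {}" and "central A"
  shows "fHP UNIV A (inverse Y) (\<lambda>x. inverse (T x)) =
    (- Y) powi (- int (arr_rank UNIV A)) * T (top_elem UNIV A) * fHP UNIV A Y T"
proof (rule fHP_reciprocity)
  show "Y \<noteq> 0" by (simp add: Y_def indet_Y_def)
  show "T x \<noteq> 0" for x
    using indet_neq(1)[of x] by (simp add: T_def indet_T_def)
  have one: "to_fract [:to_fract 1:] = (1 :: ('k ^ 'n) set ratfun)"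
    by (simp flip: one_pCons)
  show "T x \<noteq> 1" for x
  proof
    assume "T x = 1"
    then have "to_fract [:to_fract (indet x):] = (to_fract [:to_fract 1:] :: ('k ^ 'n) set ratfun)"
      unfolding T_def indet_T_def using one by (rule trans[OF _ sym])
    then show False
      using indet_neq(2)[of x] by (auto simp only: to_fract_eq_iff pCons_eq_iff)
  qed
qed fact+

end
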